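(* Let $k\geq 3$ and let $F$ be a $k$-uniform hypergraph. If $|V(F)|\geq k+1$ and $F$ is not isomorphic to $D_2$, then there is a constant $C>0$ such that for every sufficiently large $n$ there exists an induced $F$-free $k$-uniform hypergraph $H$ on $n$ vertices such that every homogeneous set of $H$ has size at most $(\log n)^{C}$.
   Context: Hypergraphs are finite. $D_2$ denotes the $3$-uniform hypergraph with $4$ vertices and $2$ edges. A $k$-uniform hypergraph $H$ is induced $F$-free if no vertex subset $U\subseteq V(H)$ induces a sub-hypergraph $H[U]$ (whose edges are all the edges of $H$ contained in $U$) isomorphic to $F$. A homogeneous set of a $k$-uniform hypergraph is a clique (a vertex set all of whose $k$-subsets are edges) or an independent set (a vertex set none of whose $k$-subsets is an edge). *)

theory Defs
  imports Complex_Main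
begin

datatype 'a hypergraph = Hypergraph (verts: "'a set") (edges: "'a set set")

definition uniform_hypergraph :: "nat \<Rightarrow> 'a hypergraph \<Rightarrow> bool" where
  "uniform_hypergraph k H \<longleftrightarrow>
     finite (verts H) \<and> (\<forall>e\<in>edges H. e \<subseteq> verts H \<and> card e = k)"

definition isomorphic :: "'a hypergraph \<Rightarrow> 'b hypergraph \<Rightarrow> bool" where
  "isomorphic G H \<longleftrightarrow>
     (\<exists>f. bij_betw f (verts G) (verts H) \<and> edges H = (\<lambda>e. f ` e) ` edges G)"

definition induced :: "'a hypergraph \<Rightarrow> 'a set \<Rightarrow> 'a hypergraph" where
  "induced H U = Hypergraph U {e \<in> edges H. e \<subseteq> U}"

definition induced_free :: "'b hypergraph \<Rightarrow> 'a hypergraph \<Rightarrow> bool" where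
  "induced_free F H \<longleftrightarrow> \<not> (\<exists>U\<subseteq>verts H. isomorphic (induced H U) F)"

text \<open>Cliques and independent sets refer to the uniformity \<open>k\<close>; a vertex set with fewer than
  \<open>k\<close> elements is both.\<close>

definition clique :: "nat \<Rightarrow> 'a hypergraph \<Rightarrow> 'a set \<Rightarrow> bool" where
  "clique k H S \<longleftrightarrow> S \<subseteq> verts H \<and> (\<forall>e. e \<subseteq> S \<and> card e = k \<longrightarrow> e \<in> edges H)"

definition independent :: "nat \<Rightarrow> 'a hypergraph \<Rightarrow> 'a set \<Rightarrow> bool" where
  "independent k H S \<longleftrightarrow> S \<subseteq> verts H \<and> (\<forall>e. e \<subseteq> S \<and> card e = k \<longrightarrow> e \<notin> edges H)"

definition homogeneous :: "nat \<Rightarrow> 'a hypergraph \<Rightarrow> 'a set \<Rightarrow> bool" where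
  "homogeneous k H S \<longleftrightarrow> clique k H S \<or> independent k H S"

text \<open>Any two distinct 3-subsets of a 4-element set share two points, so up to isomorphism this is
  the only 3-uniform hypergraph with 4 vertices and 2 edges.\<close>

definition D2 :: "nat hypergraph" where
  "D2 = Hypergraph {0, 1, 2, 3} {{0, 1, 2}, {0, 1, 3}}"

end

theory Submission
  imports Defs "HOL-Library.Disjoint_Sets"
begin

text \<open>A uniformly random relation \<open>A\<close> on the ordered set \<open>{..<n}\<close> contains every fixed ordered
  pattern inside every vertex set of polylogarithmic size. Let \<open>H\<close> consist of the \<open>k\<close>-sets
  \<open>x\<^sub>0 < \<dots> < x\<^bsub>k-1\<^esub>\<close> in which \<open>(x\<^sub>i, x\<^sub>j) \<in> A\<close> holds exactly for odd \<open>i + j\<close>, \<open>i < j\<close>. Every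
  \<open>k + 1\<close> vertices of \<open>H\<close> span at most two edges, so \<open>H\<close> has no large homogeneous set, and \<open>H\<close> or
  its complement avoids \<open>F\<close> as soon as some \<open>k + 1\<close> vertices of \<open>F\<close> do not span exactly two edges
  or \<open>k > 3\<close>. Otherwise \<open>k = 3\<close> and all \<open>4\<close>-subsets of \<open>F\<close> span two edges; if \<open>F\<close> is not \<open>D2\<close>, it has
  at least five vertices, and the triangles of the random graph avoid it.\<close>

section \<open>Counting relations and the union bound\<close>

text \<open>Independence without probability: a relation is determined by its part outside
  \<open>B i\<close> and its trace on \<open>B i\<close>. Disjointness keeps the conditions for the
  other indices inside \<open>E - B i\<close>, and one value of the trace is forbidden, so each
  index contributes a factor of at most \<open>1 - 1 / 2 ^ K\<close>.\<close>

lemma card_avoiding_traces: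
  fixes E :: "'a set" and B T :: "'i \<Rightarrow> 'a set"
  assumes "finite I" "finite E"
    and "\<And>i. i \<in> I \<Longrightarrow> B i \<subseteq> E" "\<And>i. i \<in> I \<Longrightarrow> T i \<subseteq> B i"
    and "\<And>i. i \<in> I \<Longrightarrow> card (B i) \<le> K"
    and "disjoint_family_on B I"
  shows "real (card {A \<in> Pow E. \<forall>i\<in>I. A \<inter> B i \<noteq> T i})
           \<le> 2 ^ card E * (1 - 1 / 2 ^ K) ^ card I"
  using assms
proof (induction I arbitrary: E rule: finite_induct)
  case empty
  then show ?case by (simp add: card_Pow flip: Pow_def)
next
  case (insert i I)
  define E' where "E' = E - B i"
  let ?X = "{A \<in> Pow E. \<forall>j\<in>insert i I. A \<inter> B j \<noteq> T j}"
  let ?Y = "{A \<in> Pow E'. \<forall>j\<in>I. A \<inter> B j \<noteq> T j}"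
  have BE: "B i \<subseteq> E" and TB: "T i \<subseteq> B i" and bK: "card (B i) \<le> K"
    using insert.prems by auto
  have fB: "finite (B i)" using BE insert.prems(1) finite_subset by blast
  have disj: "B j \<inter> B i = {}" if "j \<in> I" for j
    using insert.prems(5) insert.hyps(2) that by (intro disjoint_family_onD[of B "insert i I"]) auto
  have sub: "B j \<subseteq> E'" if "j \<in> I" for j
    using disj[OF that] insert.prems(2)[of j] that unfolding E'_def by auto
  have IH: "real (card ?Y) \<le> 2 ^ card E' * (1 - 1 / 2 ^ K) ^ card I"
  proof (rule insert.IH)
    show "finite E'" using insert.prems(1) E'_def by simp
    show "disjoint_family_on B I"
      using insert.prems(5) by (auto simp: disjoint_family_on_def)
  qed (use sub insert.prems in auto)
  have "inj_on (\<lambda>A. (A - B i, A \<inter> B i)) ?X"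
    by (rule inj_onI) blast
  moreover have "(\<lambda>A. (A - B i, A \<inter> B i)) ` ?X \<subseteq> ?Y \<times> (Pow (B i) - {T i})"
  proof safe
    fix A j assume A: "\<forall>j\<in>insert i I. A \<inter> B j \<noteq> T j" and j: "j \<in> I"
      and eq: "(A - B i) \<inter> B j = T j"
    have "(A - B i) \<inter> B j = A \<inter> B j" using disj[OF j] by blast
    then show False using A j eq by auto
  qed (auto simp: E'_def)
  moreover have "finite (?Y \<times> (Pow (B i) - {T i}))"
    using fB insert.prems(1) by (simp add: E'_def)
  ultimately have "card ?X \<le> card (?Y \<times> (Pow (B i) - {T i}))"
    by (rule card_inj_on_le)
  also have "\<dots> = card ?Y * (2 ^ card (B i) - 1)"
    using TB fB by (simp add: card_cartesian_product card_Diff_singleton card_Pow)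
  finally have "real (card ?X) \<le> real (card ?Y * (2 ^ card (B i) - 1))"
    by (simp only: of_nat_le_iff)
  then have X: "real (card ?X) \<le> real (card ?Y) * (2 ^ card (B i) - 1)"
    by (simp add: of_nat_diff)
  have "(2::real) ^ card (B i) \<le> 2 ^ K" using bK by (intro power_increasing) auto
  then have "(2::real) ^ card (B i) - 1 \<le> 2 ^ card (B i) * (1 - 1 / 2 ^ K)"
    by (simp add: field_simps)
  then have Y: "real (card ?Y) * (2 ^ card (B i) - 1)
      \<le> (2 ^ card E' * (1 - 1 / 2 ^ K) ^ card I) * (2 ^ card (B i) * (1 - 1 / 2 ^ K))"
    using IH by (intro mult_mono) auto
  note X
  also note Y
  also have "\<dots> = 2 ^ (card E' + card (B i)) * (1 - 1 / 2 ^ K) ^ card (insert i I)"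
    using insert.hyps by (simp add: power_add)
  also have "card E' + card (B i) = card E"
    unfolding E'_def using BE insert.prems(1) fB by (simp add: card_Diff_subset card_mono)
  finally show ?case .
qed

text \<open>The family consists of the lines \<open>y = a + b i\<close> in a \<open>k \<times> k r\<close> grid laid out along \<open>S\<close>
  column by column; two points with different \<open>i\<close> determine the line.\<close>

lemma pair_disjoint_tuples:
  fixes S :: "nat set" and k r :: nat
  assumes "finite S" "card S = k * (k * r)"
  obtains x :: "nat \<times> nat \<Rightarrow> nat \<Rightarrow> nat" where
    "\<And>l. l \<in> {..<r} \<times> {..<r} \<Longrightarrow> strict_mono_on {..<k} (x l) \<and> x l ` {..<k} \<subseteq> S"
    "disjoint_family_on (\<lambda>l. {(x l i, x l j) | i j. i < j \<and> j < k}) ({..<r} \<times> {..<r})"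
proof -
  define e where "e = (\<lambda>i. sorted_list_of_set S ! i)"
  have e_less: "e i < e j" if "i < j" "j < card S" for i j
    using that strict_sorted_list_of_set[of S] unfolding e_def
    by (simp add: sorted_wrt_iff_nth_less)
  have e_in: "e i \<in> S" if "i < card S" for i
    using that assms(1) unfolding e_def
    by (metis length_sorted_list_of_set nth_mem set_sorted_list_of_set)
  have e_inj: "i = j" if "e i = e j" "i < card S" "j < card S" for i j
    using that e_less by (metis less_irrefl linorder_neqE_nat)
  \<comment> \<open>Column \<open>i\<close> is the block of \<open>k * r\<close> consecutive indices
    starting at \<open>i * (k * r)\<close>; the line \<open>(a, b)\<close> meets it at height
    \<open>a + i * b\<close>.\<close>
  define x where "x = (\<lambda>(a, b) i. e (i * (k * r) + (a + i * b)))"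
  have small: "a + i * b < k * r" if "a < r" "b < r" "i < k" for a b i
  proof -
    have "a + i * b < r + i * r" using that by (intro add_less_le_mono) auto
    also have "\<dots> = Suc i * r" by simp
    also have "\<dots> \<le> k * r" using that by (intro mult_le_mono1) simp
    finally show ?thesis .
  qed
  have ind_less: "i * (k * r) + (a + i * b) < card S" if "a < r" "b < r" "i < k" for a b i
  proof -
    have "i * (k * r) + (a + i * b) < Suc i * (k * r)" using small[OF that] by simp
    also have "\<dots> \<le> k * (k * r)" using that by (intro mult_le_mono1) simp
    finally show ?thesis using assms by simp
  qed
  have mono: "x (a, b) i < x (a, b) j" if "a < r" "b < r" "i < j" "j < k" for a b i j
  proof -
    have "i * (k * r) + (a + i * b) < Suc i * (k * r)" using small[of a b i] that by simp
    also have "\<dots> \<le> j * (k * r)" using that by (intro mult_le_mono1) simp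
    finally have "i * (k * r) + (a + i * b) < j * (k * r) + (a + j * b)" by simp
    then show ?thesis using e_less ind_less that unfolding x_def by simp
  qed
  have point: "i = i' \<and> a + i * b = a' + i * b'"
    if "a < r" "b < r" "a' < r" "b' < r" "i < k" "i' < k" "x (a, b) i = x (a', b') i'" for a b a' b' i i'
  proof -
    have eq: "i * (k * r) + (a + i * b) = i' * (k * r) + (a' + i' * b')"
      using that e_inj ind_less unfolding x_def by simp
    \<comment> \<open>Heights stay below \<open>k * r\<close>, so division recovers the
      column.\<close>
    have "i = (i * (k * r) + (a + i * b)) div (k * r)"
      using small[of a b i] that by simp
    also have "\<dots> = i'" using small[of a' b' i'] that eq by simp
    finally show ?thesis using eq by simp
  qed
  show ?thesis
  proof (rule that[of x])
    fix l :: "nat \<times> nat" assume "l \<in> {..<r} \<times> {..<r}"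
    then obtain a b where "l = (a, b)" "a < r" "b < r" by auto
    then show "strict_mono_on {..<k} (x l) \<and> x l ` {..<k} \<subseteq> S"
      using mono e_in ind_less by (auto simp: strict_mono_on_def x_def)
  next
    have "a = a' \<and> b = b'"
      if "a < r" "b < r" "a' < r" "b' < r" "i < j" "j < k" "i' < j'" "j' < k"
        "x (a, b) i = x (a', b') i'" "x (a, b) j = x (a', b') j'" for a b a' b' i j i' j'
    proof -
      have 1: "a + i * b = a' + i * b'" "a + j * b = a' + j * b'"
        using point[of a b a' b' i i'] point[of a b a' b' j j'] that by auto
      obtain d where d: "j = i + d" "d > 0" using \<open>i < j\<close> less_imp_add_positive by blast
      have "a + i * b + d * b = a' + i * b' + d * b'"
        using 1(2) unfolding d by (simp add: add_mult_distrib)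
      then have "d * b = d * b'" using 1(1) by linarith
      then have "b = b'" using d by simp
      then show ?thesis using 1 by simp
    qed
    then show "disjoint_family_on (\<lambda>l. {(x l i, x l j) | i j. i < j \<and> j < k}) ({..<r} \<times> {..<r})"
      unfolding disjoint_family_on_def by (auto; metis)
  qed
qed

text \<open>Only increasing pairs are consulted, so \<open>A\<close> acts as a graph on ordered
  vertices and \<open>c\<close> as an ordered graph on \<open>k\<close> points.\<close>

definition has_pattern :: "nat \<Rightarrow> (nat \<Rightarrow> nat \<Rightarrow> bool) \<Rightarrow> (nat \<times> nat) set \<Rightarrow> nat set \<Rightarrow> bool" where
  "has_pattern k c A S \<longleftrightarrow> (\<exists>x. strict_mono_on {..<k} x \<and> x ` {..<k} \<subseteq> S \<and>
     (\<forall>i j. i < j \<and> j < k \<longrightarrow> ((x i, x j) \<in> A \<longleftrightarrow> c i j)))"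

lemma has_pattern_mono: "has_pattern k c A S \<Longrightarrow> S \<subseteq> S' \<Longrightarrow> has_pattern k c A S'"
  unfolding has_pattern_def by (meson subset_trans)

text \<open>The \<open>r * r\<close> tuples found inside \<open>S\<close> share no pair, so their
  failures are independent. The exponent is quadratic in \<open>r\<close> while
  \<open>card S\<close> is linear in it, which lets this bound beat the number of choices for
  \<open>S\<close>.\<close>

lemma card_no_pattern:
  fixes n k r :: nat
  assumes S: "S \<subseteq> {..<n}" "card S = k * (k * r)"
  shows "real (card {A \<in> Pow ({..<n} \<times> {..<n}). \<not> has_pattern k c A S})
           \<le> 2 ^ (n * n) * (1 - 1 / 2 ^ (k * k)) ^ (r * r)"
proof -
  have "finite S" using S finite_subset by blast
  then obtain x where x: "\<And>l. l \<in> {..<r} \<times> {..<r} \<Longrightarrow> strict_mono_on {..<k} (x l) \<and> x l ` {..<k} \<subseteq> S"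
    and dis: "disjoint_family_on (\<lambda>l. {(x l i, x l j) | i j. i < j \<and> j < k}) ({..<r} \<times> {..<r})"
    by (rule pair_disjoint_tuples[OF _ S(2)]) blast
  define B where "B = (\<lambda>l. {(x l i, x l j) | i j. i < j \<and> j < k})"
  define T where "T = (\<lambda>l. {(x l i, x l j) | i j. i < j \<and> j < k \<and> c i j})"
  let ?I = "{..<r} \<times> {..<r}" and ?E = "{..<n} \<times> {..<n}"
  have "{A \<in> Pow ?E. \<not> has_pattern k c A S} \<subseteq> {A \<in> Pow ?E. \<forall>l\<in>?I. A \<inter> B l \<noteq> T l}"
  proof (rule subsetI)
    fix A assume A: "A \<in> {A \<in> Pow ?E. \<not> has_pattern k c A S}"
    have "A \<inter> B l \<noteq> T l" if l: "l \<in> ?I" for l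
    proof
      assume eq: "A \<inter> B l = T l"
      \<comment> \<open>A pair determines its indices, so membership in \<open>T l\<close> tests
        exactly \<open>c i j\<close>.\<close>
      have inj: "x l i = x l i' \<Longrightarrow> i < k \<Longrightarrow> i' < k \<Longrightarrow> i = i'" for i i'
        using x[OF l] strict_mono_on_imp_inj_on[of "{..<k}" "x l"] by (auto dest: inj_onD)
      have "(x l i, x l j) \<in> A \<longleftrightarrow> c i j" if ij: "i < j" "j < k" for i j
      proof -
        have "(x l i, x l j) \<in> B l" using ij unfolding B_def by blast
        then have "(x l i, x l j) \<in> A \<longleftrightarrow> (x l i, x l j) \<in> T l" using eq by blast
        also have "\<dots> \<longleftrightarrow> c i j"
        proof
          assume "(x l i, x l j) \<in> T l"
          then obtain i' j' where "x l i = x l i'" "x l j = x l j'" "i' < j'" "j' < k" "c i' j'"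
            unfolding T_def by blast
          then show "c i j" using inj[of i i'] inj[of j j'] ij by simp
        qed (use ij in \<open>auto simp: T_def\<close>)
        finally show ?thesis .
      qed
      then have "has_pattern k c A S" unfolding has_pattern_def using x[OF l] by blast
      then show False using A by simp
    qed
    then show "A \<in> {A \<in> Pow ?E. \<forall>l\<in>?I. A \<inter> B l \<noteq> T l}" using A by simp
  qed
  then have "card {A \<in> Pow ?E. \<not> has_pattern k c A S} \<le> card {A \<in> Pow ?E. \<forall>l\<in>?I. A \<inter> B l \<noteq> T l}"
    by (intro card_mono) auto
  also have "real \<dots> \<le> 2 ^ card ?E * (1 - 1 / 2 ^ (k * k)) ^ card ?I"
  proof (rule card_avoiding_traces)
    fix l assume l: "l \<in> ?I"
    have "B l \<subseteq> S \<times> S" using x[OF l] unfolding B_def by fastforce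
    then show "B l \<subseteq> ?E" using S by blast
    show "T l \<subseteq> B l" unfolding B_def T_def by blast
    have "B l \<subseteq> (\<lambda>(i, j). (x l i, x l j)) ` ({..<k} \<times> {..<k})"
      unfolding B_def by force
    then have "card (B l) \<le> card ({..<k} \<times> {..<k})"
      by (meson card_image_le card_mono finite_SigmaI finite_imageI finite_lessThan le_trans)
    then show "card (B l) \<le> k * k" by simp
  qed (use dis in \<open>auto simp: B_def\<close>)
  finally show ?thesis by simp
qed

lemma card_subsets_le_power:
  fixes V :: "'a set"
  assumes "finite V"
  shows "card {S. S \<subseteq> V \<and> card S = s} \<le> card V ^ s"
proof -
  have "{S. S \<subseteq> V \<and> card S = s} \<subseteq> set ` {xs. set xs \<subseteq> V \<and> length xs = s}"
  proof
    fix S assume S: "S \<in> {S. S \<subseteq> V \<and> card S = s}"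
    then obtain xs where "set xs = S" "distinct xs"
      using finite_distinct_list assms finite_subset by (metis mem_Collect_eq)
    then show "S \<in> set ` {xs. set xs \<subseteq> V \<and> length xs = s}"
      using S distinct_card[of xs] by auto
  qed
  then have "card {S. S \<subseteq> V \<and> card S = s} \<le> card {xs. set xs \<subseteq> V \<and> length xs = s}"
    using finite_lists_length_eq[OF assms] by (meson card_image_le card_mono finite_imageI le_trans)
  then show ?thesis using card_lists_length_eq[OF assms] by simp
qed

text \<open>A union bound: there are at most \<open>n ^ (k * (k * r))\<close> sets, and each fails
  for a proportion of at most \<open>exp (- r * r / 2 ^ (k * k))\<close> of all relations. The
  hypothesis on \<open>r\<close> says that the quadratic exponent wins.\<close>

lemma ex_universal_relation:
  fixes n k r :: nat
  assumes n: "n > 0" and r: "real (k * k * 2 ^ (k * k)) * ln n < r"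
  shows "\<exists>A. \<forall>S\<subseteq>{..<n}. card S = k * (k * r) \<longrightarrow> has_pattern k c A S"
proof (rule ccontr)
  let ?E = "{..<n} \<times> {..<n}" and ?F = "{S. S \<subseteq> {..<n} \<and> card S = k * (k * r)}"
  define d :: real where "d = 1 / 2 ^ (k * k)"
  assume "\<not> ?thesis"
  then have "Pow ?E \<subseteq> (\<Union>S\<in>?F. {A \<in> Pow ?E. \<not> has_pattern k c A S})" by fastforce
  moreover have fF: "finite ?F" by simp
  ultimately have "card (Pow ?E) \<le> card (\<Union>S\<in>?F. {A \<in> Pow ?E. \<not> has_pattern k c A S})"
    by (intro card_mono) auto
  also have "\<dots> \<le> (\<Sum>S\<in>?F. card {A \<in> Pow ?E. \<not> has_pattern k c A S})"
    by (rule card_UN_le[OF fF])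
  finally have "real (card (Pow ?E)) \<le> (\<Sum>S\<in>?F. real (card {A \<in> Pow ?E. \<not> has_pattern k c A S}))"
    by (simp only: of_nat_le_iff flip: of_nat_sum)
  also have "\<dots> \<le> (\<Sum>S\<in>?F. 2 ^ (n * n) * (1 - d) ^ (r * r))"
    unfolding d_def by (intro sum_mono card_no_pattern) auto
  also have "\<dots> = real (card ?F) * (2 ^ (n * n) * (1 - d) ^ (r * r))" by simp
  finally have "2 ^ (n * n) * 1 \<le> 2 ^ (n * n) * (real (card ?F) * (1 - d) ^ (r * r))"
    by (simp add: card_Pow mult_ac)
  then have 1: "1 \<le> real (card ?F) * (1 - d) ^ (r * r)"
    by (subst (asm) mult_le_cancel_left_pos) auto
  have d: "0 < d" "d \<le> 1" unfolding d_def by auto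
  have "real (card ?F) \<le> real (n ^ (k * (k * r)))"
    using card_subsets_le_power[of "{..<n}" "k * (k * r)"] by (simp only: of_nat_le_iff card_lessThan finite_lessThan)
  also have "\<dots> = exp (real (k * (k * r)) * ln n)"
    using n by (simp add: exp_of_nat_mult del: of_nat_mult)
  finally have F: "real (card ?F) \<le> exp (real (k * (k * r)) * ln n)" .
  have "(1 - d) ^ (r * r) \<le> exp (- d) ^ (r * r)"
    using d exp_ge_add_one_self[of "- d"] by (intro power_mono) auto
  also have "\<dots> = exp (- (d * real (r * r)))"
    by (metis exp_of_nat2_mult minus_mult_left)
  finally have D: "(1 - d) ^ (r * r) \<le> exp (- (d * real (r * r)))" .
  have "1 \<le> exp (real (k * (k * r)) * ln n) * exp (- (d * real (r * r)))"
    using 1 mult_mono[OF F D] d by simp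
  then have "0 \<le> real (k * (k * r)) * ln n - d * real (r * r)"
    by (simp flip: exp_add)
  moreover have "real (k * k) * ln n < d * r"
    using r unfolding d_def by (simp add: field_simps)
  moreover have "0 < r"
  proof -
    have "0 \<le> real (k * k * 2 ^ (k * k)) * ln n" using n by (intro mult_nonneg_nonneg) auto
    then show ?thesis using r by linarith
  qed
  ultimately have "real r * (real (k * k) * ln n) < r * (d * r)" and
      "r * (d * r) \<le> real r * (real (k * k) * ln n)"
    by (simp_all add: algebra_simps)
  then show False by simp
qed

lemma ex_polylog_universal_relation:
  "\<exists>N. \<forall>n\<ge>N. 1 \<le> ln (real n) \<and>
     (\<exists>A. \<forall>S\<subseteq>{..<n}. real (card S) > ln (real n) ^ 3 \<longrightarrow> has_pattern k c A S)"
proof -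
  \<comment> \<open>The first summand makes \<open>L * L\<close> exceed the threshold for
    \<open>r\<close>, the second absorbs the factor \<open>2 * k * k\<close> in the size of the
    sets, and the last gives \<open>1 \<le> L\<close>.\<close>
  define D :: real where "D = real (k * k * 2 ^ (k * k)) + 2 * real (k * k) + 1"
  have "eventually (\<lambda>n::nat. D \<le> ln (real n)) at_top"
    using filterlim_compose[OF ln_at_top filterlim_real_sequentially]
    by (simp add: filterlim_at_top)
  then obtain N where N: "\<And>n. n \<ge> N \<Longrightarrow> D \<le> ln (real n)"
    by (auto simp: eventually_at_top_linorder)
  show ?thesis
  proof (intro exI allI impI)
    fix n :: nat assume "n \<ge> N"
    define L where "L = ln (real n)"
    \<comment> \<open>With \<open>r\<close> about the square of \<open>L\<close>, the sets have at
      most \<open>L ^ 3\<close> points: the extra factor \<open>L\<close> pays for all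
      constants.\<close>
    define r where "r = nat \<lceil>L\<^sup>2\<rceil>"
    have L: "D \<le> L" using N[OF \<open>n \<ge> N\<close>] L_def by simp
    have L1: "1 \<le> L" using order_trans[OF _ L, of 1] unfolding D_def by simp
    \<comment> \<open>Here \<open>ln 0 = 0\<close>, so \<open>1 \<le> L\<close> excludes
      \<open>n = 0\<close>.\<close>
    have n: "n > 0" using L1 unfolding L_def by (cases n) auto
    have "real r = of_int \<lceil>L\<^sup>2\<rceil>" unfolding r_def by simp
    then have r: "L\<^sup>2 \<le> r" "r \<le> L\<^sup>2 + 1" by linarith+
    have "real (k * k * 2 ^ (k * k)) < L"
      using L of_nat_0_le_iff[of "k * k", where ?'a = real] unfolding D_def by linarith
    then have "real (k * k * 2 ^ (k * k)) * L < L * L" using L1 by (intro mult_strict_right_mono) auto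
    then have "real (k * k * 2 ^ (k * k)) * ln n < r" using r L_def by (simp add: power2_eq_square)
    from ex_universal_relation[OF n this, of c] obtain A
      where A: "\<And>S. S \<subseteq> {..<n} \<Longrightarrow> card S = k * (k * r) \<Longrightarrow> has_pattern k c A S" by blast
    have "real (k * (k * r)) \<le> real (k * k) * (L\<^sup>2 + 1)" using r mult_left_mono[of r "L\<^sup>2 + 1" "real (k * k)"] by (simp add: mult.assoc)
    also have "\<dots> \<le> real (k * k) * (2 * L\<^sup>2)"
      using L1 by (intro mult_left_mono) auto
    also have "\<dots> = (2 * real (k * k)) * L\<^sup>2" by simp
    also have "\<dots> \<le> L * L\<^sup>2" using L unfolding D_def by (intro mult_right_mono) (auto intro: order_trans[rotated])
    also have "\<dots> = L ^ 3" by (simp add: power2_eq_square power3_eq_cube)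
    finally have small: "real (k * (k * r)) \<le> L ^ 3" .
    have "has_pattern k c A S" if S: "S \<subseteq> {..<n}" "real (card S) > ln (real n) ^ 3" for S
    proof -
      have "k * (k * r) \<le> card S" using S small unfolding L_def by linarith
      then obtain S' where "S' \<subseteq> S" "card S' = k * (k * r)"
        by (meson obtain_subset_with_card_n)
      then show ?thesis using A[of S'] S has_pattern_mono by blast
    qed
    then show "1 \<le> ln (real n) \<and>
        (\<exists>A. \<forall>S\<subseteq>{..<n}. real (card S) > ln (real n) ^ 3 \<longrightarrow> has_pattern k c A S)"
      using L1 L_def by blast
  qed
qed

section \<open>Hypergraphs defined by ordered patterns\<close>

definition position :: "nat set \<Rightarrow> nat \<Rightarrow> nat" where
  "position e x = card {y \<in> e. y < x}"

text \<open>The edges are the increasing copies of the ordered graph \<open>c\<close>; positions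
  count from 0, like the indices in \<open>has_pattern\<close>. For \<open>k = 3\<close> and
  \<open>c\<close> constantly true these are the triangles of the graph \<open>A\<close>, for
  \<open>c\<close> constantly false its independent triples.\<close>

definition pattern_hypergraph ::
    "nat \<Rightarrow> nat \<Rightarrow> (nat \<Rightarrow> nat \<Rightarrow> bool) \<Rightarrow> (nat \<times> nat) set \<Rightarrow> nat hypergraph" where
  "pattern_hypergraph n k c A = Hypergraph {..<n}
     {e. e \<subseteq> {..<n} \<and> card e = k \<and>
       (\<forall>x\<in>e. \<forall>y\<in>e. x < y \<longrightarrow> ((x, y) \<in> A \<longleftrightarrow> c (position e x) (position e y)))}"

definition edges_within :: "'a hypergraph \<Rightarrow> 'a set \<Rightarrow> 'a set set" where
  "edges_within H W = {e \<in> edges H. e \<subseteq> W}"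

definition complement :: "nat \<Rightarrow> 'a hypergraph \<Rightarrow> 'a hypergraph" where
  "complement k H = Hypergraph (verts H) {e. e \<subseteq> verts H \<and> card e = k \<and> e \<notin> edges H}"

lemma finite_edges_within: "finite W \<Longrightarrow> finite (edges_within H W)"
  by (rule finite_subset[of _ "Pow W"]) (auto simp: edges_within_def)

lemma verts_pattern_hypergraph [simp]: "verts (pattern_hypergraph n k c A) = {..<n}"
  by (simp add: pattern_hypergraph_def)

lemma uniform_pattern_hypergraph: "uniform_hypergraph k (pattern_hypergraph n k c A)"
  by (simp add: uniform_hypergraph_def pattern_hypergraph_def)

lemma verts_complement [simp]: "verts (complement k H) = verts H"
  by (simp add: complement_def)

lemma uniform_complement: "finite (verts H) \<Longrightarrow> uniform_hypergraph k (complement k H)"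
  by (simp add: uniform_hypergraph_def complement_def)

lemma homogeneous_complement: "homogeneous k (complement k H) S \<longleftrightarrow> homogeneous k H S"
  unfolding homogeneous_def clique_def independent_def complement_def by auto

lemma card_edges_within_complement:
  assumes "uniform_hypergraph k H" "W \<subseteq> verts H" "card W = Suc k"
  shows "card (edges_within (complement k H) W) + card (edges_within H W) = Suc k"
proof -
  have fW: "finite W" using assms(3) card.infinite by fastforce
  have "edges_within (complement k H) W \<union> edges_within H W = {e. e \<subseteq> W \<and> card e = k}"
    using assms unfolding edges_within_def complement_def uniform_hypergraph_def by auto
  moreover have "edges_within (complement k H) W \<inter> edges_within H W = {}"
    unfolding edges_within_def complement_def by auto
  ultimately have "card (edges_within (complement k H) W) + card (edges_within H W)
      = card {e. e \<subseteq> W \<and> card e = k}"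
    using card_Un_disjoint fW finite_edges_within by metis
  then show ?thesis using n_subsets[OF fW, of k] assms(3) by simp
qed

text \<open>The window of \<open>k\<close> consecutive points starting at index \<open>l\<close> of
  a longer pattern is itself a copy of \<open>c\<close>. The offset allows two different triples to
  be read off one pattern.\<close>

lemma has_pattern_imp_edge:
  assumes "has_pattern m d A S" "S \<subseteq> {..<n}" "l + k \<le> m"
    and "\<And>i j. i < j \<Longrightarrow> j < k \<Longrightarrow> d (l + i) (l + j) = c i j"
  obtains e where "e \<subseteq> S" "card e = k" "e \<in> edges (pattern_hypergraph n k c A)"
proof -
  from assms(1) obtain x where "strict_mono_on {..<m} x \<and> x ` {..<m} \<subseteq> S \<and>
      (\<forall>i j. i < j \<and> j < m \<longrightarrow> ((x i, x j) \<in> A \<longleftrightarrow> d i j))"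
    unfolding has_pattern_def by (elim exE)
  then have x: "strict_mono_on {..<m} x" "x ` {..<m} \<subseteq> S"
    "\<And>i j. i < j \<Longrightarrow> j < m \<Longrightarrow> (x i, x j) \<in> A \<longleftrightarrow> d i j"
    by simp_all
  define y where "y = (\<lambda>i. x (l + i))"
  have less: "y i < y j" if "i < j" "j < k" for i j
    using x(1) that assms(3) unfolding y_def by (auto simp: strict_mono_on_def)
  have le: "i < j" if "y i < y j" "i < k" "j < k" for i j
    using less[of j i] that by (cases i j rule: linorder_cases) auto
  have inj: "inj_on y {..<k}"
    by (rule linorder_inj_onI) (use less in force)+
  \<comment> \<open>Since \<open>y\<close> increases, the points of the image below
    \<open>y i\<close> are those with smaller index.\<close>
  have pos: "position (y ` {..<k}) (y i) = i" if "i < k" for i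
  proof -
    have "{z \<in> y ` {..<k}. z < y i} = y ` {..<i}"
    proof (intro set_eqI iffI)
      fix z assume "z \<in> {z \<in> y ` {..<k}. z < y i}"
      then obtain j where "j < k" "z = y j" "y j < y i" by auto
      then show "z \<in> y ` {..<i}" using le[of j i] that by simp
    next
      fix z assume "z \<in> y ` {..<i}"
      then obtain j where "j < i" "z = y j" by auto
      then show "z \<in> {z \<in> y ` {..<k}. z < y i}" using less[of j i] that by simp
    qed
    then show ?thesis unfolding position_def
      using that inj by (simp add: card_image inj_on_subset)
  qed
  have sub: "y ` {..<k} \<subseteq> S" using x(2) assms(3) unfolding y_def by auto
  have "(y i, y j) \<in> A \<longleftrightarrow> c i j" if "i < j" "j < k" for i j
    using x(3)[of "l + i" "l + j"] assms(3,4) that unfolding y_def by simp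
  then have "y ` {..<k} \<in> edges (pattern_hypergraph n k c A)"
    unfolding pattern_hypergraph_def using sub assms(2) pos le inj
    by (auto simp: card_image)
  then show thesis using that[of "y ` {..<k}"] sub inj by (simp add: card_image)
qed

section \<open>Edge counts on small vertex sets\<close>

text \<open>Deleting \<open>a\<close> lowers by one the position of exactly the points above
  \<open>a\<close>.\<close>

lemma odd_position_delete:
  assumes "finite W" "a \<in> W"
  shows "odd (position (W - {a}) x) \<longleftrightarrow> odd (position W x) \<noteq> (a < x)"
proof (cases "a < x")
  case True
  then have "{y \<in> W. y < x} = insert a {y \<in> W - {a}. y < x}" using assms by auto
  then show ?thesis using True assms unfolding position_def by simp
next
  case False
  then have "{y \<in> W. y < x} = {y \<in> W - {a}. y < x}" by auto
  then show ?thesis using False unfolding position_def by simp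
qed

text \<open>The parity of \<open>position e x + position e y\<close> has to be the same in both edges, and passing
  from one edge to the other shifts exactly the positions of the points between \<open>a\<close> and \<open>b\<close>.\<close>

lemma two_parity_edges:
  fixes A :: "(nat \<times> nat) set"
  defines "H \<equiv> \<lambda>n k. pattern_hypergraph n k (\<lambda>i j. odd (i + j)) A"
  assumes "finite W" "a \<in> W" "b \<in> W" "a < b"
    and "W - {a} \<in> edges (H n k)" "W - {b} \<in> edges (H n k)"
    and "x \<in> W - {a, b}" "y \<in> W - {a, b}"
  shows "a < x \<and> x < b \<longleftrightarrow> a < y \<and> y < b"
proof -
  have *: "a < x \<and> x < b \<longleftrightarrow> a < y \<and> y < b"
    if "x \<in> W - {a, b}" "y \<in> W - {a, b}" "x < y" for x y
  proof -
    let ?P = "\<lambda>a. odd (position (W - {a}) x + position (W - {a}) y)"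
    have "(x, y) \<in> A \<longleftrightarrow> ?P d"
      if "W - {d} \<in> edges (H n k)" "x \<in> W - {d}" "y \<in> W - {d}" for d
      using that \<open>x < y\<close> unfolding H_def pattern_hypergraph_def by simp
    from this[of a] this[of b] have "?P a \<longleftrightarrow> ?P b"
      using assms(6,7) that by simp
    \<comment> \<open>The positions in \<open>W\<close> itself occur on both sides and cancel; only
      the shifts caused by the two deletions remain.\<close>
    then have "((a < x) \<noteq> (a < y)) = ((b < x) \<noteq> (b < y))"
      using odd_position_delete[OF assms(2)] assms(3,4) by auto
    then show ?thesis using that \<open>a < b\<close>
      by (cases "a < x"; cases "b < x"; cases "a < y"; cases "b < y") auto
  qed
  show ?thesis using *[of x y] *[of y x] assms(8,9) by (cases x y rule: linorder_cases) auto
qed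

lemma edge_eq_delete:
  assumes "finite W" "card W = Suc k" "e \<subseteq> W" "card e = k"
  shows "\<exists>a\<in>W. e = W - {a}"
proof -
  have "card (W - e) = 1" using assms by (simp add: card_Diff_subset finite_subset)
  then obtain a where "W - e = {a}" by (auto simp: card_1_singleton_iff)
  then show ?thesis using assms(3) by (intro bexI[of _ a]) blast+
qed

text \<open>Three edges would be deletions of points \<open>a < b < c\<close>, and
  \<open>k \<ge> 3\<close> provides a fourth point \<open>x\<close>. Comparing \<open>x\<close> with
  the third deleted point, the pairs \<open>a, b\<close> and \<open>b, c\<close> keep
  \<open>x\<close> out of both inner intervals, whereas the pair \<open>a, c\<close> forces
  \<open>x\<close> between \<open>a\<close> and \<open>c\<close>, because \<open>b\<close> lies
  there.\<close>

lemma card_parity_edges_le_2: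
  assumes "k \<ge> 3" "W \<subseteq> {..<n}" "card W = Suc k"
  shows "card (edges_within (pattern_hypergraph n k (\<lambda>i j. odd (i + j)) A) W) \<le> 2"
proof (rule ccontr)
  let ?H = "pattern_hypergraph n k (\<lambda>i j. odd (i + j)) A"
  assume "\<not> ?thesis"
  then have big: "3 \<le> card (edges_within ?H W)" by simp
  have fW: "finite W" using assms(2) finite_subset by blast
  define D where "D = {a \<in> W. W - {a} \<in> edges ?H}"
  have "edges_within ?H W \<subseteq> (\<lambda>a. W - {a}) ` D"
  proof
    fix e assume e: "e \<in> edges_within ?H W"
    then have "e \<subseteq> W" "card e = k" unfolding edges_within_def pattern_hypergraph_def by auto
    then obtain a where "a \<in> W" "e = W - {a}" using edge_eq_delete fW assms(3) by blast
    then show "e \<in> (\<lambda>a. W - {a}) ` D" using e unfolding D_def edges_within_def by blast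
  qed
  moreover have fD: "finite D" using fW unfolding D_def by simp
  ultimately have "3 \<le> card D" using big by (meson card_image_le card_mono finite_imageI le_trans)
  define a c where "a = Min D" and "c = Max D"
  have "D \<noteq> {}" using \<open>3 \<le> card D\<close> by auto
  then have ac: "a \<in> D" "c \<in> D" "\<And>d. d \<in> D \<Longrightarrow> a \<le> d \<and> d \<le> c"
    using fD unfolding a_def c_def by auto
  have "\<not> D \<subseteq> {a, c}"
    using \<open>3 \<le> card D\<close> card_mono[of "{a, c}" D] by (auto simp: card_insert_if split: if_splits)
  then obtain b where b: "b \<in> D" "b \<noteq> a" "b \<noteq> c" by blast
  then have abc: "a < b" "b < c" using ac(3)[of b] by auto
  have D: "a \<in> W" "b \<in> W" "c \<in> W" "W - {a} \<in> edges ?H" "W - {b} \<in> edges ?H" "W - {c} \<in> edges ?H"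
    using ac b unfolding D_def by auto
  have "\<not> W \<subseteq> {a, b, c}"
    using assms(1,3) card_mono[of "{a, b, c}" W] by (auto simp: card_insert_if split: if_splits)
  then obtain x where x: "x \<in> W" "x \<noteq> a" "x \<noteq> b" "x \<noteq> c" by blast
  have "a < x \<and> x < b \<longleftrightarrow> a < c \<and> c < b"
    by (rule two_parity_edges[OF fW _ _ _ D(4,5)]) (use D x abc in auto)
  moreover have "b < x \<and> x < c \<longleftrightarrow> b < a \<and> a < c"
    by (rule two_parity_edges[OF fW _ _ _ D(5,6)]) (use D x abc in auto)
  moreover have "a < x \<and> x < c \<longleftrightarrow> a < b \<and> b < c"
    by (rule two_parity_edges[OF fW _ _ _ D(4,6)]) (use D x abc in auto)
  ultimately show False using x abc by linarith
qed

text \<open>The pentagon, the \<open>3\<close>-uniform hypergraph on \<open>5\<close> vertices all of whose \<open>4\<close>-subsets span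
  two edges, is not the triangle hypergraph of a graph.\<close>

lemma triangle_hypergraph_no_pentagon:
  assumes Y: "Y \<subseteq> {..<n}" "card Y = 5"
  shows "\<exists>W\<subseteq>Y. card W = 4 \<and> card (edges_within (pattern_hypergraph n 3 (\<lambda>_ _. True) A) W) \<noteq> 2"
proof (rule ccontr)
  let ?H = "pattern_hypergraph n 3 (\<lambda>_ _. True) A"
  assume "\<not> ?thesis"
  then have two: "\<And>W. W \<subseteq> Y \<Longrightarrow> card W = 4 \<Longrightarrow> card (edges_within ?H W) = 2" by blast
  \<comment> \<open>Edges consult \<open>A\<close> only on increasing pairs; \<open>R\<close> is the
    corresponding symmetric adjacency.\<close>
  define R where "R = (\<lambda>x y. (min x y, max x y) \<in> A)"
  have R_sym: "R x y = R y x" for x y unfolding R_def by (simp add: min.commute max.commute)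
  have edge: "e \<in> edges ?H \<longleftrightarrow> e \<subseteq> {..<n} \<and> card e = 3 \<and> (\<forall>x\<in>e. \<forall>y\<in>e. x \<noteq> y \<longrightarrow> R x y)" for e
    unfolding pattern_hypergraph_def R_def
    by (auto simp: min_def max_def)
  have fY: "finite Y" using Y finite_subset by blast
  \<comment> \<open>If all pairs were adjacent, a 4-subset would span four triangles.\<close>
  have "\<exists>u\<in>Y. \<exists>v\<in>Y. u \<noteq> v \<and> \<not> R u v"
  proof (rule ccontr)
    assume "\<not> ?thesis"
    then have all: "\<And>u v. u \<in> Y \<Longrightarrow> v \<in> Y \<Longrightarrow> u \<noteq> v \<Longrightarrow> R u v" by blast
    obtain W where W: "W \<subseteq> Y" "card W = 4"
      using obtain_subset_with_card_n[of 4 Y] Y(2) by auto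
    have "edges_within ?H W = {e. e \<subseteq> W \<and> card e = 3}"
      using W Y(1) all unfolding edges_within_def edge by blast
    then have "card (edges_within ?H W) = 4 choose 3"
      using n_subsets[of W 3] W fY finite_subset by metis
    also have "4 choose 3 = (4::nat)" by (simp add: numeral_eq_Suc)
    finally show False using two[OF W] by simp
  qed
  then obtain u v where uv: "u \<in> Y" "v \<in> Y" "u \<noteq> v" "\<not> R u v" by blast
  have "card (Y - {u, v}) = 3" using uv Y fY by (simp add: card_Diff_subset)
  then obtain p q r where pqr: "Y - {u, v} = {p, q, r}" "p \<noteq> q" "q \<noteq> r" "p \<noteq> r"
    by (auto simp: card_3_iff)
  then have Ypqr: "Y = {u, v, p, q, r}" using uv by blast
  have ne: "p \<noteq> u" "q \<noteq> u" "r \<noteq> u" "p \<noteq> v" "q \<noteq> v" "r \<noteq> v" using pqr(1) by blast+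
  \<comment> \<open>No triangle contains both \<open>u\<close> and \<open>v\<close>, so the two
    triangles on \<open>{u, v, x, y}\<close> can only be \<open>{u, x, y}\<close> and
    \<open>{v, x, y}\<close>, and both must occur.\<close>
  have mem: "{u, x, y} \<in> edges ?H"
    if xy: "x \<in> {p, q, r}" "y \<in> {p, q, r}" "x \<noteq> y" for x y
  proof -
    have d: "x \<noteq> u" "y \<noteq> u" "x \<noteq> v" "y \<noteq> v" using xy ne by auto
    have "edges_within ?H {u, v, x, y} \<subseteq> {{u, x, y}, {v, x, y}}"
    proof
      fix e assume e: "e \<in> edges_within ?H {u, v, x, y}"
      then have sub: "e \<subseteq> {u, v, x, y}" and c: "card e = 3" and "\<not> (u \<in> e \<and> v \<in> e)"
        using uv unfolding edges_within_def edge by auto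
      then have "e \<subseteq> {u, x, y} \<or> e \<subseteq> {v, x, y}" by blast
      moreover have "card {u, x, y} = 3" "card {v, x, y} = 3" using d xy by auto
      ultimately show "e \<in> {{u, x, y}, {v, x, y}}"
        using c by (metis card_subset_eq finite.emptyI finite.insertI insert_iff)
    qed
    moreover have "card (edges_within ?H {u, v, x, y}) = 2"
      using xy d uv Ypqr by (intro two) auto
    moreover have "{u, x, y} \<noteq> {v, x, y}" using d uv by blast
    ultimately have "edges_within ?H {u, v, x, y} = {{u, x, y}, {v, x, y}}"
      by (intro card_subset_eq) auto
    then show ?thesis unfolding edges_within_def by blast
  qed
  have E: "{u, p, q} \<in> edges ?H" "{u, p, r} \<in> edges ?H" "{u, q, r} \<in> edges ?H"
    using mem pqr by blast+
  \<comment> \<open>The three triangles at \<open>u\<close> already contain all sides of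
    \<open>{p, q, r}\<close>, so \<open>{u, p, q, r}\<close> spans more than two triangles.\<close>
  have "{p, q, r} \<in> edges ?H"
  proof -
    have R: "R x y" if "e \<in> edges ?H" "x \<in> e" "y \<in> e" "x \<noteq> y" for e x y
      using that edge by simp
    have "R p q" "R p r" "R q r"
      using R[OF E(1), of p q] R[OF E(2), of p r] R[OF E(3), of q r] pqr by simp_all
    moreover from this have "R q p" "R r p" "R r q" using R_sym by simp_all
    moreover have "card {p, q, r} = 3" "{p, q, r} \<subseteq> {..<n}" using pqr Ypqr Y by auto
    ultimately show ?thesis by (simp add: edge)
  qed
  then have "{{u, p, q}, {u, p, r}, {p, q, r}} \<subseteq> edges_within ?H {u, p, q, r}"
    using E unfolding edges_within_def by blast
  then have "card {{u, p, q}, {u, p, r}, {p, q, r}} \<le> card (edges_within ?H {u, p, q, r})"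
    by (intro card_mono finite_edges_within) auto
  moreover have "q \<notin> {u, p, r}" "u \<notin> {p, q, r}" using pqr(2-4) ne by simp_all
  then have "{u, p, q} \<noteq> {u, p, r}" "{u, p, q} \<noteq> {p, q, r}" "{u, p, r} \<noteq> {p, q, r}" by blast+
  then have "card {{u, p, q}, {u, p, r}, {p, q, r}} = 3" by simp
  moreover have "card (edges_within ?H {u, p, q, r}) = 2"
  proof (rule two)
    show "{u, p, q, r} \<subseteq> Y" unfolding Ypqr by blast
    show "card {u, p, q, r} = 4" using pqr(2-4) ne by simp
  qed
  ultimately show False by simp
qed

section \<open>Constructions with polylogarithmic homogeneous sets\<close>

lemma not_independent_if_edge: "e \<subseteq> S \<Longrightarrow> card e = k \<Longrightarrow> e \<in> edges H \<Longrightarrow> \<not> independent k H S"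
  unfolding independent_def by blast

text \<open>A clique on \<open>k + 1\<close> points would span \<open>k + 1 > 2\<close> edges, so
  cliques have at most \<open>k\<close> points. A larger independent set than allowed would contain
  a copy of the parity pattern, which is an edge.\<close>

lemma ex_parity_hypergraph:
  assumes "k \<ge> 3"
  shows "\<exists>N. \<forall>n\<ge>N. 1 \<le> ln (real n) \<and> (\<exists>H. uniform_hypergraph k H \<and> verts H = {..<n} \<and>
    (\<forall>W\<subseteq>{..<n}. card W = Suc k \<longrightarrow> card (edges_within H W) \<le> 2) \<and>
    (\<forall>S. homogeneous k H S \<longrightarrow> real (card S) \<le> ln (real n) ^ 3))"
proof -
  let ?c = "\<lambda>i j. odd (i + j :: nat)"
  obtain N1 where N1: "\<And>n. n \<ge> N1 \<Longrightarrow> 1 \<le> ln (real n) \<and>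
     (\<exists>A. \<forall>S\<subseteq>{..<n}. real (card S) > ln (real n) ^ 3 \<longrightarrow> has_pattern k ?c A S)"
    using ex_polylog_universal_relation[of k ?c] by blast
  \<comment> \<open>The constant bound \<open>k\<close> on cliques has to lie below the logarithmic
    bound.\<close>
  obtain N2 :: nat where N2: "\<And>n. n \<ge> N2 \<Longrightarrow> real k \<le> ln (real n)"
    using filterlim_compose[OF ln_at_top filterlim_real_sequentially]
    unfolding filterlim_at_top eventually_at_top_linorder by blast
  show ?thesis
  proof (intro exI allI impI)
    fix n assume n: "n \<ge> max N1 N2"
    obtain A where A: "\<And>S. S \<subseteq> {..<n} \<Longrightarrow> real (card S) > ln (real n) ^ 3 \<Longrightarrow> has_pattern k ?c A S"
      and L: "1 \<le> ln (real n)"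
      using N1[of n] n by auto
    let ?H = "pattern_hypergraph n k ?c A"
    have two: "\<forall>W\<subseteq>{..<n}. card W = Suc k \<longrightarrow> card (edges_within ?H W) \<le> 2"
      using card_parity_edges_le_2[OF assms] by blast
    have "real (card S) \<le> ln (real n) ^ 3" if "homogeneous k ?H S" for S
      using that unfolding homogeneous_def
    proof
      assume cl: "clique k ?H S"
      have "\<not> Suc k \<le> card S"
      proof
        assume "Suc k \<le> card S"
        then obtain W where W: "W \<subseteq> S" "card W = Suc k" "finite W"
          by (meson obtain_subset_with_card_n)
        have "edges_within ?H W = {e. e \<subseteq> W \<and> card e = k}"
        proof (intro set_eqI iffI)
          fix e assume "e \<in> edges_within ?H W"
          then show "e \<in> {e. e \<subseteq> W \<and> card e = k}"
            using uniform_pattern_hypergraph[of k n ?c A]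
            by (simp add: edges_within_def uniform_hypergraph_def)
        next
          fix e assume "e \<in> {e. e \<subseteq> W \<and> card e = k}"
          then show "e \<in> edges_within ?H W"
            using cl order_trans[OF _ W(1)] by (simp add: clique_def edges_within_def)
        qed
        then have "card (edges_within ?H W) = Suc k" using n_subsets[OF W(3), of k] W(2) by simp
        moreover have "W \<subseteq> {..<n}" using W cl unfolding clique_def by auto
        ultimately show False using two[rule_format, of W] W(2) assms by simp
      qed
      then have "real (card S) \<le> ln (real n)" using N2[of n] n by linarith
      also have "\<dots> \<le> ln (real n) ^ 3" using L by (simp add: self_le_power)
      finally show ?thesis .
    next
      assume ind: "independent k ?H S"
      show ?thesis
      proof (rule ccontr)
        assume "\<not> ?thesis"
        moreover have S: "S \<subseteq> {..<n}" using ind unfolding independent_def by simp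
        ultimately have "has_pattern k ?c A S" using A by simp
        then obtain e where "e \<subseteq> S" "card e = k" "e \<in> edges ?H"
          using has_pattern_imp_edge[of k ?c A S n 0 k ?c] S by auto
        then show False using ind not_independent_if_edge by blast
      qed
    qed
    then show "1 \<le> ln (real n) \<and> (\<exists>H. uniform_hypergraph k H \<and> verts H = {..<n} \<and>
      (\<forall>W\<subseteq>{..<n}. card W = Suc k \<longrightarrow> card (edges_within H W) \<le> 2) \<and>
      (\<forall>S. homogeneous k H S \<longrightarrow> real (card S) \<le> ln (real n) ^ 3))"
      using L two by (intro conjI exI[of _ ?H]) (simp_all add: uniform_pattern_hypergraph)
  qed
qed

text \<open>A copy of the \<open>6\<close>-point pattern below has a triangle on its first three points and an
  independent triple on its last three.\<close>

lemma ex_pentagon_free_hypergraph: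
  "\<exists>N. \<forall>n\<ge>N. 1 \<le> ln (real n) \<and> (\<exists>H. uniform_hypergraph 3 H \<and> verts H = {..<n} \<and>
    (\<forall>Y\<subseteq>{..<n}. card Y = 5 \<longrightarrow> (\<exists>W\<subseteq>Y. card W = 4 \<and> card (edges_within H W) \<noteq> 2)) \<and>
    (\<forall>S. homogeneous 3 H S \<longrightarrow> real (card S) \<le> ln (real n) ^ 3))"
proof -
  \<comment> \<open>Read for \<open>i < j\<close>: a pair is related exactly if its larger index is
    below 3, so indices 0, 1, 2 form a triangle and 3, 4, 5 are mutually unrelated.\<close>
  let ?d = "\<lambda>i j. j < (3::nat)" and ?c = "\<lambda>_ _. True"
  obtain N where N: "\<And>n. n \<ge> N \<Longrightarrow> 1 \<le> ln (real n) \<and>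
     (\<exists>A. \<forall>S\<subseteq>{..<n}. real (card S) > ln (real n) ^ 3 \<longrightarrow> has_pattern 6 ?d A S)"
    using ex_polylog_universal_relation[of 6 ?d] by blast
  show ?thesis
  proof (intro exI allI impI)
    fix n assume n: "n \<ge> N"
    obtain A where A: "\<And>S. S \<subseteq> {..<n} \<Longrightarrow> real (card S) > ln (real n) ^ 3 \<Longrightarrow> has_pattern 6 ?d A S"
      and L: "1 \<le> ln (real n)"
      using N[of n] n by auto
    let ?H = "pattern_hypergraph n 3 ?c A"
    have pentagon: "\<forall>Y\<subseteq>{..<n}. card Y = 5 \<longrightarrow>
        (\<exists>W\<subseteq>Y. card W = 4 \<and> card (edges_within ?H W) \<noteq> 2)"
      using triangle_hypergraph_no_pentagon by simp
    have "real (card S) \<le> ln (real n) ^ 3" if "homogeneous 3 ?H S" for S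
    proof (rule ccontr)
      assume "\<not> ?thesis"
      moreover have S: "S \<subseteq> {..<n}"
        using that unfolding homogeneous_def clique_def independent_def by auto
      ultimately have pat: "has_pattern 6 ?d A S" using A by simp
      obtain e where "e \<subseteq> S" "card e = 3" "e \<in> edges ?H"
        using has_pattern_imp_edge[of 6 ?d A S n 0 3 ?c] S pat by auto
      then have "\<not> independent 3 ?H S" using not_independent_if_edge by blast
      moreover obtain e where e: "e \<subseteq> S" "card e = 3"
          "e \<in> edges (pattern_hypergraph n 3 (\<lambda>_ _. False) A)"
        using has_pattern_imp_edge[of 6 ?d A S n 3 3 "\<lambda>_ _. False"] S pat by auto
      \<comment> \<open>The constant patterns contradict each other on every increasing pair, so a
        common edge would have at most one point.\<close>
      have "e \<notin> edges ?H"
      proof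
        assume "e \<in> edges ?H"
        then have "\<forall>x\<in>e. \<forall>y\<in>e. \<not> x < y" using e(3) by (auto simp: pattern_hypergraph_def)
        then have "\<forall>x\<in>e. \<forall>y\<in>e. x = y" by (meson linorder_neqE_nat)
        then have "card e \<le> Suc 0" by (metis card_eq_0_iff card_le_Suc0_iff_eq le0)
        then show False using e(2) by simp
      qed
      then have "\<not> clique 3 ?H S" using e unfolding clique_def by blast
      ultimately show False using that unfolding homogeneous_def by blast
    qed
    then show "1 \<le> ln (real n) \<and> (\<exists>H. uniform_hypergraph 3 H \<and> verts H = {..<n} \<and>
      (\<forall>Y\<subseteq>{..<n}. card Y = 5 \<longrightarrow> (\<exists>W\<subseteq>Y. card W = 4 \<and> card (edges_within H W) \<noteq> 2)) \<and>
      (\<forall>S. homogeneous 3 H S \<longrightarrow> real (card S) \<le> ln (real n) ^ 3))"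
      using L pentagon by (intro conjI exI[of _ ?H]) (simp_all add: uniform_pattern_hypergraph)
  qed
qed

section \<open>Induced copies and edge counts\<close>

text \<open>Both ways of excluding \<open>F\<close> compare only numbers of edges inside small
  vertex sets; an isomorphism maps these edges bijectively.\<close>

lemma isomorphic_induced_card_edges_within:
  assumes "isomorphic (induced H U) F"
  obtains f where "bij_betw f U (verts F)"
    and "\<And>W. W \<subseteq> U \<Longrightarrow> card (edges_within F (f ` W)) = card (edges_within H W)"
proof -
  obtain f where f: "bij_betw f U (verts F)" and E: "edges F = (`) f ` {e \<in> edges H. e \<subseteq> U}"
    using assms unfolding isomorphic_def induced_def by auto
  have inj: "inj_on f U" using f bij_betw_def by blast
  have "card (edges_within F (f ` W)) = card (edges_within H W)" if W: "W \<subseteq> U" for W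
  proof -
    have "edges_within F (f ` W) = (`) f ` edges_within H W"
    proof (intro set_eqI iffI)
      fix e assume "e \<in> edges_within F (f ` W)"
      then obtain e' where e': "e = f ` e'" "e' \<in> edges H" "e' \<subseteq> U" "f ` e' \<subseteq> f ` W"
        unfolding edges_within_def E by auto
      have "e' \<subseteq> W"
      proof
        \<comment> \<open>Injectivity on all of \<open>U\<close> pulls the inclusion of images back
          to the sets.\<close>
        fix z assume "z \<in> e'"
        then have "f z \<in> f ` W" "z \<in> U" using e'(3,4) by auto
        then show "z \<in> W" using inj_on_image_mem_iff[OF inj _ W] by simp
      qed
      then show "e \<in> (`) f ` edges_within H W" using e' unfolding edges_within_def by blast
    qed (use W in \<open>auto simp: edges_within_def E\<close>)
    moreover have "inj_on ((`) f) (edges_within H W)"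
      by (rule inj_on_subset[OF inj_on_image_Pow[OF inj]]) (use W in \<open>auto simp: edges_within_def\<close>)
    ultimately show ?thesis by (simp add: card_image)
  qed
  then show thesis using that f by blast
qed

lemma induced_freeI_card_edges_within:
  assumes "W \<subseteq> verts F"
    and "\<And>W'. W' \<subseteq> verts H \<Longrightarrow> card W' = card W \<Longrightarrow>
      card (edges_within H W') \<noteq> card (edges_within F W)"
  shows "induced_free F H"
  unfolding induced_free_def
proof safe
  fix U assume U: "U \<subseteq> verts H" "isomorphic (induced H U) F"
  obtain f where f: "bij_betw f U (verts F)"
    and E: "\<And>W. W \<subseteq> U \<Longrightarrow> card (edges_within F (f ` W)) = card (edges_within H W)"
    using isomorphic_induced_card_edges_within[OF U(2)] by blast
  obtain W' where W': "W' \<subseteq> U" "W = f ` W'"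
    using assms(1) f by (metis bij_betw_imp_surj_on subset_imageE)
  have "card W = card W'" using f W' by (metis bij_betw_def card_image inj_on_subset)
  then show False using assms(2)[of W'] E[of W'] W' U by auto
qed

text \<open>Each of the two edges misses one vertex, say \<open>p\<close> and \<open>q\<close>. The
  two common vertices go to 0 and 1, and \<open>q\<close> and \<open>p\<close> go to 2 and
  3.\<close>

lemma isomorphic_D2I:
  assumes F: "uniform_hypergraph 3 F" "card (verts F) = 4" "card (edges F) = 2"
  shows "isomorphic F D2"
proof -
  obtain e1 e2 where e: "edges F = {e1, e2}" "e1 \<noteq> e2" using F(3) by (auto simp: card_2_iff)
  have fV: "finite (verts F)" using F by (simp add: uniform_hypergraph_def)
  have del: "\<exists>a\<in>verts F. e = verts F - {a}" if "e \<in> edges F" for e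
    using F that by (intro edge_eq_delete[of _ 3]) (auto simp: uniform_hypergraph_def)
  obtain p where p: "p \<in> verts F" "e1 = verts F - {p}" using del[of e1] e(1) by (metis insertI1)
  obtain q where q: "q \<in> verts F" "e2 = verts F - {q}"
    using del[of e2] e(1) by (metis insertI1 insertI2)
  note pq = p(1) q(1) p(2) q(2)
  then have "p \<noteq> q" using e by blast
  then have "card (verts F - {p, q}) = 2" using pq F fV by (simp add: card_Diff_subset)
  then obtain r s where rs: "verts F - {p, q} = {r, s}" "r \<noteq> s" by (auto simp: card_2_iff)
  then have V: "verts F = {p, q, r, s}" using pq by blast
  have ne: "r \<noteq> p" "r \<noteq> q" "s \<noteq> p" "s \<noteq> q" using rs by blast+
  have e12: "e1 = {q, r, s}" "e2 = {p, r, s}" using pq V ne rs \<open>p \<noteq> q\<close> by auto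
  define f where "f = (\<lambda>_. 0::nat)(r := 0, s := 1, q := 2, p := 3)"
  have f: "f r = 0" "f s = 1" "f q = 2" "f p = 3"
    using ne rs \<open>p \<noteq> q\<close> unfolding f_def by auto
  have "bij_betw f (verts F) (verts D2)"
    unfolding bij_betw_def V D2_def using f by (auto simp: inj_on_def)
  moreover have "edges D2 = (`) f ` edges F"
    unfolding e e12 D2_def using f by (auto simp: insert_commute)
  ultimately show ?thesis unfolding isomorphic_def by blast
qed

section \<open>Choosing the hypergraph according to \<open>F\<close>\<close>

theorem claim1p3:
  fixes k :: nat and F :: "'a hypergraph"
  assumes "k \<ge> 3"
    and "uniform_hypergraph k F"
    and "card (verts F) \<ge> k + 1"
    and "\<not> isomorphic F D2"
  shows "\<exists>C::real. C > 0 \<and>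
    (\<exists>N::nat. \<forall>n\<ge>N. \<exists>H :: nat hypergraph.
        uniform_hypergraph k H \<and> card (verts H) = n \<and> induced_free F H \<and>
        (\<forall>S. homogeneous k H S \<longrightarrow> real (card S) \<le> ln (real n) powr C))"
proof -
  have "\<exists>N. \<forall>n\<ge>N. 1 \<le> ln (real n) \<and> (\<exists>H :: nat hypergraph.
      uniform_hypergraph k H \<and> verts H = {..<n} \<and> induced_free F H \<and>
      (\<forall>S. homogeneous k H S \<longrightarrow> real (card S) \<le> ln (real n) ^ 3))"
  \<comment> \<open>A single set \<open>W\<close> suffices for the parity construction, except when
    \<open>k = 3\<close> and every 4-subset of \<open>F\<close> spans exactly two edges.\<close>
  proof (cases "\<exists>W\<subseteq>verts F. card W = Suc k \<and> (k \<noteq> 3 \<or> card (edges_within F W) \<noteq> 2)")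
    case True
    then obtain W where W: "W \<subseteq> verts F" "card W = Suc k" "k \<noteq> 3 \<or> card (edges_within F W) \<noteq> 2"
      by blast
    obtain N where N: "\<And>n. n \<ge> N \<Longrightarrow> 1 \<le> ln (real n) \<and> (\<exists>H. uniform_hypergraph k H \<and> verts H = {..<n} \<and>
        (\<forall>W\<subseteq>{..<n}. card W = Suc k \<longrightarrow> card (edges_within H W) \<le> 2) \<and>
        (\<forall>S. homogeneous k H S \<longrightarrow> real (card S) \<le> ln (real n) ^ 3))"
      using ex_parity_hypergraph[OF assms(1)] by blast
    show ?thesis
    proof (intro exI[of _ N] allI impI conjI)
      fix n assume "n \<ge> N"
      then show "1 \<le> ln (real n)" using N by blast
      obtain H where H: "uniform_hypergraph k H" "verts H = {..<n}"
        "\<And>W. W \<subseteq> {..<n} \<Longrightarrow> card W = Suc k \<Longrightarrow> card (edges_within H W) \<le> 2"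
        "\<And>S. homogeneous k H S \<Longrightarrow> real (card S) \<le> ln (real n) ^ 3"
        using N[OF \<open>n \<ge> N\<close>] by blast
      show "\<exists>H :: nat hypergraph. uniform_hypergraph k H \<and> verts H = {..<n} \<and> induced_free F H \<and>
        (\<forall>S. homogeneous k H S \<longrightarrow> real (card S) \<le> ln (real n) ^ 3)"
      proof (cases "card (edges_within F W) \<ge> 3")
        case True
        have "induced_free F H"
        proof (rule induced_freeI_card_edges_within[OF W(1)])
          fix W' assume "W' \<subseteq> verts H" "card W' = card W"
          then show "card (edges_within H W') \<noteq> card (edges_within F W)"
            using H(2) H(3)[of W'] True W(2) by simp
        qed
        then show ?thesis using H by blast
      next
        case False
        \<comment> \<open>In the complement, \<open>k + 1\<close> points span at least
          \<open>k - 1\<close> edges. For \<open>k \<ge> 4\<close> this is at least 3, for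
          \<open>k = 3\<close> at least 2; in the latter case \<open>W\<close> spans at most one
          edge, as two are excluded.\<close>
        have "induced_free F (complement k H)"
        proof (rule induced_freeI_card_edges_within[OF W(1)])
          fix W' assume "W' \<subseteq> verts (complement k H)" "card W' = card W"
          then show "card (edges_within (complement k H) W') \<noteq> card (edges_within F W)"
            using card_edges_within_complement[OF H(1), of W'] H(2) H(3)[of W'] W False assms(1) by auto
        qed
        then show ?thesis
          using H uniform_complement[of H k]
          by (intro exI[of _ "complement k H"]) (simp add: homogeneous_complement)
      qed
    qed
  next
    case False
    obtain W where "W \<subseteq> verts F" "card W = Suc k"
      using assms(3) obtain_subset_with_card_n[of "Suc k" "verts F"] by auto
    then have k: "k = 3" using False by blast
    have two: "card (edges_within F W) = 2" if "W \<subseteq> verts F" "card W = 4" for W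
      using False that k by auto
    \<comment> \<open>On four vertices, two edges would make \<open>F\<close> isomorphic to
      \<open>D2\<close>; hence \<open>F\<close> has at least five vertices.\<close>
    have "card (verts F) \<noteq> 4"
    proof
      assume V: "card (verts F) = 4"
      have "edges_within F (verts F) = edges F"
        using assms(2) unfolding edges_within_def uniform_hypergraph_def by blast
      then show False using isomorphic_D2I[of F] two[of "verts F"] V assms(2,4) k by simp
    qed
    then obtain Y where Y: "Y \<subseteq> verts F" "card Y = 5"
      using assms(3) k obtain_subset_with_card_n[of 5 "verts F"] by auto
    \<comment> \<open>A copy of \<open>F\<close> would contain a preimage of \<open>Y\<close>, whose
      4-subsets would then all span two edges.\<close>
    have free: "induced_free F H"
      if bad: "\<And>Y. Y \<subseteq> verts H \<Longrightarrow> card Y = 5 \<Longrightarrow> \<exists>W\<subseteq>Y. card W = 4 \<and> card (edges_within H W) \<noteq> 2"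
      for H :: "nat hypergraph"
      unfolding induced_free_def
    proof safe
      fix U assume U: "U \<subseteq> verts H" "isomorphic (induced H U) F"
      obtain f where f: "bij_betw f U (verts F)"
        and E: "\<And>W. W \<subseteq> U \<Longrightarrow> card (edges_within F (f ` W)) = card (edges_within H W)"
        using isomorphic_induced_card_edges_within[OF U(2)] by blast
      have card_f: "card (f ` W) = card W" if "W \<subseteq> U" for W
        using f that by (metis bij_betw_def card_image inj_on_subset)
      obtain Y' where Y': "Y' \<subseteq> U" "Y = f ` Y'"
        using Y f by (metis bij_betw_imp_surj_on subset_imageE)
      then obtain W where W: "W \<subseteq> Y'" "card W = 4" "card (edges_within H W) \<noteq> 2"
        using bad[of Y'] Y(2) card_f[of Y'] U(1) by auto
      moreover have "f ` W \<subseteq> verts F" using W Y' Y by blast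
      ultimately show False using two[of "f ` W"] E[of W] card_f[of W] Y' by auto
    qed
    show ?thesis using ex_pentagon_free_hypergraph free unfolding k by metis
  qed
  then obtain N where N: "\<And>n. n \<ge> N \<Longrightarrow> 1 \<le> ln (real n) \<and> (\<exists>H :: nat hypergraph.
      uniform_hypergraph k H \<and> verts H = {..<n} \<and> induced_free F H \<and>
      (\<forall>S. homogeneous k H S \<longrightarrow> real (card S) \<le> ln (real n) ^ 3))"
    by blast
  show ?thesis
  \<comment> \<open>The exponent is that of the cubic bounds; \<open>powr 3\<close> agrees with the
    third power because \<open>ln n\<close> is at least 1.\<close>
  proof (intro exI[of _ "3::real"] conjI exI[of _ N] allI impI)
    fix n assume "n \<ge> N"
    then obtain H :: "nat hypergraph" where "1 \<le> ln (real n)"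
      "uniform_hypergraph k H" "verts H = {..<n}" "induced_free F H"
      "\<And>S. homogeneous k H S \<Longrightarrow> real (card S) \<le> ln (real n) ^ 3"
      using N by blast
    then show "\<exists>H :: nat hypergraph. uniform_hypergraph k H \<and> card (verts H) = n \<and>
        induced_free F H \<and> (\<forall>S. homogeneous k H S \<longrightarrow> real (card S) \<le> ln (real n) powr 3)"
      by (intro exI[of _ H]) (simp add: powr_numeral)
  qed simp
qed

end
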